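(* Let $\epsilon>0$ be fixed. Consider a run of the $\epsilon$-trading process described in the context, with trading states $y^k$, arranged trades $p^k$ and curtailment factors $\gamma^k$. Suppose that: (i) no $\epsilon$-unworthy trade in the feasible direction is ever arranged, and any $\epsilon$-worthy trade in the feasible direction will eventually be identified and arranged; that is, for every iteration $k$ and every feasible-direction trade $p$ at $y^k$ that is $\epsilon$-worthy at $y^k$, there is an iteration $k'\ge k$ at which either $p^{k'}=p$ is arranged or $p$ is no longer an $\epsilon$-worthy feasible-direction trade at $y^{k'}$; (ii) once an $\epsilon$-worthy feasible-direction trade is identified, the participants involved are willing to carry it out; that is, the process does not terminate at iteration $k$ if some $\epsilon$-worthy feasible-direction trade at $y^k$ exists. Then the $\epsilon$-trading process is well-defined (whenever a trade $p^k$ is arranged, the curtailment factor $\gamma^k\in(0,1]$ exists, and the updated state $y^{k+1}$ is again feasible for the social welfare maximization problem), and $$U^\star-\lim_{k\to\infty}U(y^k)\le\epsilon ,$$ where $U^\star$ is the optimal value of the social welfare maximization problem.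
   Context: **Network.** There are $N$ buses and $L$ lines. With $\widehat H\in\mathbb R^{L\times N}$ and line capacities $\bar r\in\mathbb R^L$, put $H=\begin{bmatrix}\widehat H\\-\widehat H\end{bmatrix}$, $\bar f=\begin{bmatrix}\bar r\\ \bar r\end{bmatrix}$, and let $h_\ell^\top$ be the rows of $H$ (loading vectors). The set of feasible nodal injections is $\mathcal P=\{p\in\mathbb R^N: Hp\le\bar f,\ \mathbf 1^\top p=0\}$, where $\mathbf 1$ is the all-one vector. It is assumed that $\mathcal P$ has nonempty interior relative to $\{p:\mathbf 1^\top p=0\}$. **Uncertainty.** There are finitely many scenarios $s\in[S]=\{1,\dots,S\}$, with probabilities $\mathbb P(s)>0$ summing to $1$. **Participants.** $\mathcal I=\bigcup_{n\in[N]}\mathcal I_n$ is a finite set of participants, $\mathcal I_n$ (pairwise disjoint) being those at bus $n$. $\mathcal I$ is partitioned into day-ahead participants $\mathcal I^{\mathrm{DA}}$ and real-time participants $\mathcal I^{\mathrm{RT}}$. Participant $i$ has a power injection plan $p_i=(p_{i,s})_{s\in[S]}\in\mathbb R^S$. For each $s$, $\mathcal P_{i,s}=[0,\bar p_{i,s}]$ if $i$ is a producer and $\mathcal P_{i,s}=[-\bar p_{i,s},0]$ if $i$ is a load, with $\bar p_{i,s}\ge0$ finite. Let $\bar{\mathcal P}_i=\{p_i\in\mathbb R^S:p_{i,s}\in\mathcal P_{i,s}\ \forall s\}$. Set $\mathcal P_i=\bar{\mathcal P}_i$ for $i\in\mathcal I^{\mathrm{RT}}$ and $\mathcal P_i=\bar{\mathcal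 P}_i\cap\{p_i:p_{i,s}=p_{i,\tilde s}\ \forall s,\tilde s\in[S]\}$ for $i\in\mathcal I^{\mathrm{DA}}$. The utility from injection is a concave function $\tilde u_{i,s}:\mathbb R\to\mathbb R$. Utilities are quasi-linear in money and the payments within every trade are budget balanced, so payments cancel in all sums of utilities below; accordingly $U_i(p_i)=\sum_{s}\mathbb P(s)\tilde u_{i,s}(p_{i,s})$ and $U(p)=\sum_{i\in\mathcal I}U_i(p_i)$. **Social welfare maximization problem.** Maximize $U(p)$ over $(p,x)$ subject to $p_i\in\mathcal P_i$ for all $i\in\mathcal I$; $x_{n,s}=\sum_{i\in\mathcal I_n}p_{i,s}$ for all $n\in[N]$, $s\in[S]$; and $x_s=(x_{n,s})_{n}\in\mathcal P$ for all $s\in[S]$. A vector $p$ is called feasible if it satisfies these constraints with the corresponding $x$. **Trades.** Let $y=(y_{i,s})$ be a trading state, with network state $x_{n,s}=\sum_{i\in\mathcal I_n}y_{i,s}$. A (contingent multilateral) trade at $y$ is $p=(p_{i,s})_{i\in\mathcal I,s\in[S]}$ with $p_i=0$ for $i$ outside some group $\mathcal I'\subset\mathcal I$, with $y_i+p_i\in\mathcal P_i$ for all $i\in\mathcal I'$, and $\sum_{i\in\mathcal I}p_{i,s}=0$ for all $s$. Its network injection is $q_{n,s}=\sum_{i\in\mathcal I_n}p_{i,s}$. It is a feasible-direction trade at $y$ if for every $s$ and every row index $\ell$ of $H$ with $h_\ell^\top x_s=\bar f_\ell$ one has $h_\ell^\top q_s\le0$. It is $\epsilon$-worthy at $y$ if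 $\sum_{i\in\mathcal I'}\big(U_i(y_i+p_i)-U_i(y_i)\big)\ge\epsilon$, and $\epsilon$-unworthy otherwise. **$\epsilon$-trading process.** Start from a feasible $y^0$. At iteration $k$, if an $\epsilon$-worthy feasible-direction trade $p^k$ at $y^k$ is identified, it is arranged. With $x^k,q^k$ the network state and injection, the system operator sets $\gamma^k=\max\{\gamma\in[0,1]: x^k_s+\gamma q^k_s\in\mathcal P\ \forall s\in[S]\}$, so $\gamma^k=1$ if the trade is feasible and otherwise the trade is curtailed to $\gamma^kp^k$. The state is updated to $y^{k+1}=y^k+\gamma^kp^k$. If no such trade is found, the process terminates; in that case $y^{k'}=y^k$ for all $k'\ge k$ in the limit above. *)

theory Defs
  imports "HOL-Analysis.Analysis"
begin

text \<open>
  The index types stand for the buses \<open>'n\<close>, the lines \<open>'l\<close>, the scenarios \<open>'s\<close> and the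
  participants \<open>'i\<close>. The participants at bus \<open>n\<close> are \<open>{i. bus M i = n}\<close>. Every participant
  outside \<open>day_ahead M\<close> is a real-time participant, and every participant outside
  \<open>producers M\<close> is a load.
\<close>

record ('n::finite, 'l::finite, 's::finite, 'i::finite) market =
  Hhat :: "real^'n^'l"
  rbar :: "real^'l"
  scen_prob :: "'s \<Rightarrow> real"
  bus :: "'i \<Rightarrow> 'n"
  day_ahead :: "'i set"
  producers :: "'i set"
  pbar :: "real^'s^'i"
  util :: "'i \<Rightarrow> 's \<Rightarrow> real \<Rightarrow> real"

definition Hmat :: "('n::finite, 'l::finite, 's::finite, 'i::finite) market \<Rightarrow> real^'n^('l + 'l)" where
  "Hmat M = (\<chi> l. case l of Inl a \<Rightarrow> Hhat M $ a | Inr a \<Rightarrow> - (Hhat M $ a))"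

definition fbar :: "('n::finite, 'l::finite, 's::finite, 'i::finite) market \<Rightarrow> real^('l + 'l)" where
  "fbar M = (\<chi> l. case l of Inl a \<Rightarrow> rbar M $ a | Inr a \<Rightarrow> rbar M $ a)"

text \<open>Here \<open>\<le>\<close> is the componentwise order and \<open>1\<close> is the all-one vector.\<close>

definition injections :: "('n::finite, 'l::finite, 's::finite, 'i::finite) market \<Rightarrow> (real^'n) set" where
  "injections M = {p. Hmat M *v p \<le> fbar M \<and> 1 \<bullet> p = 0}"

definition valid_market :: "('n::finite, 'l::finite, 's::finite, 'i::finite) market \<Rightarrow> bool" where
  "valid_market M \<longleftrightarrow>
     top_of_set {p. 1 \<bullet> p = 0} interior_of injections M \<noteq> {} \<and>
     (\<forall>s. 0 < scen_prob M s) \<and> (\<Sum>s\<in>UNIV. scen_prob M s) = 1 \<and>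
     (\<forall>i s. 0 \<le> pbar M $ i $ s) \<and>
     (\<forall>i s. concave_on UNIV (util M i s))"

definition power_range ::
    "('n::finite, 'l::finite, 's::finite, 'i::finite) market \<Rightarrow> 'i \<Rightarrow> 's \<Rightarrow> real set" where
  "power_range M i s =
     (if i \<in> producers M then {0 .. pbar M $ i $ s} else {- (pbar M $ i $ s) .. 0})"

definition plans ::
    "('n::finite, 'l::finite, 's::finite, 'i::finite) market \<Rightarrow> 'i \<Rightarrow> (real^'s) set" where
  "plans M i =
     {v. (\<forall>s. v $ s \<in> power_range M i s) \<and> (i \<in> day_ahead M \<longrightarrow> (\<forall>s t. v $ s = v $ t))}"

definition participant_utility ::
    "('n::finite, 'l::finite, 's::finite, 'i::finite) market \<Rightarrow> 'i \<Rightarrow> real^'s \<Rightarrow> real" where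
  "participant_utility M i v = (\<Sum>s\<in>UNIV. scen_prob M s * util M i s (v $ s))"

definition welfare ::
    "('n::finite, 'l::finite, 's::finite, 'i::finite) market \<Rightarrow> real^'s^'i \<Rightarrow> real" where
  "welfare M p = (\<Sum>i\<in>UNIV. participant_utility M i (p $ i))"

definition network ::
    "('n::finite, 'l::finite, 's::finite, 'i::finite) market \<Rightarrow> real^'s^'i \<Rightarrow> real^'n^'s" where
  "network M p = (\<chi> s n. \<Sum>i | bus M i = n. p $ i $ s)"

definition feasible ::
    "('n::finite, 'l::finite, 's::finite, 'i::finite) market \<Rightarrow> real^'s^'i \<Rightarrow> bool" where
  "feasible M p \<longleftrightarrow> (\<forall>i. p $ i \<in> plans M i) \<and> (\<forall>s. network M p $ s \<in> injections M)"

definition optimal_value ::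
    "('n::finite, 'l::finite, 's::finite, 'i::finite) market \<Rightarrow> real" where
  "optimal_value M = (SUP p\<in>{p. feasible M p}. welfare M p)"

definition trade ::
    "('n::finite, 'l::finite, 's::finite, 'i::finite) market \<Rightarrow> real^'s^'i \<Rightarrow> 'i set
       \<Rightarrow> real^'s^'i \<Rightarrow> bool" where
  "trade M y G p \<longleftrightarrow>
     (\<forall>i. i \<notin> G \<longrightarrow> p $ i = 0) \<and>
     (\<forall>i\<in>G. y $ i + p $ i \<in> plans M i) \<and>
     (\<forall>s. (\<Sum>i\<in>UNIV. p $ i $ s) = 0)"

definition feasible_direction ::
    "('n::finite, 'l::finite, 's::finite, 'i::finite) market \<Rightarrow> real^'s^'i
       \<Rightarrow> real^'s^'i \<Rightarrow> bool" where
  "feasible_direction M y p \<longleftrightarrow>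
     (\<forall>s l. row l (Hmat M) \<bullet> network M y $ s = fbar M $ l \<longrightarrow>
            row l (Hmat M) \<bullet> network M p $ s \<le> 0)"

definition worthy ::
    "('n::finite, 'l::finite, 's::finite, 'i::finite) market \<Rightarrow> real \<Rightarrow> real^'s^'i \<Rightarrow> 'i set
       \<Rightarrow> real^'s^'i \<Rightarrow> bool" where
  "worthy M \<epsilon> y G p \<longleftrightarrow>
     (\<Sum>i\<in>G. participant_utility M i (y $ i + p $ i) - participant_utility M i (y $ i)) \<ge> \<epsilon>"

definition worthy_fd_trade ::
    "('n::finite, 'l::finite, 's::finite, 'i::finite) market \<Rightarrow> real \<Rightarrow> real^'s^'i
       \<Rightarrow> real^'s^'i \<Rightarrow> bool" where
  "worthy_fd_trade M \<epsilon> y p \<longleftrightarrow>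
     (\<exists>G. trade M y G p \<and> feasible_direction M y p \<and> worthy M \<epsilon> y G p)"

definition admissible_factors ::
    "('n::finite, 'l::finite, 's::finite, 'i::finite) market \<Rightarrow> real^'s^'i
       \<Rightarrow> real^'s^'i \<Rightarrow> real set" where
  "admissible_factors M y p =
     {g \<in> {0..1}. \<forall>s. network M y $ s + g *\<^sub>R network M p $ s \<in> injections M}"

text \<open>
  In a run, \<open>P k = Some p\<close> says that trade \<open>p\<close> is arranged at iteration \<open>k\<close>, and \<open>P k = None\<close>
  that the process has terminated at or before iteration \<open>k\<close>. The factor \<open>\<gamma> k\<close> is the maximum of
  the admissible factors whenever that maximum exists, and unspecified otherwise; its existence
  is not part of the definition of a run.
\<close>

definition trading_run ::
    "('n::finite, 'l::finite, 's::finite, 'i::finite) market \<Rightarrow> real \<Rightarrow> (nat \<Rightarrow> real^'s^'i)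
       \<Rightarrow> (nat \<Rightarrow> (real^'s^'i) option) \<Rightarrow> (nat \<Rightarrow> real) \<Rightarrow> bool" where
  "trading_run M \<epsilon> y P \<gamma> \<longleftrightarrow>
     feasible M (y 0) \<and>
     (\<forall>k. case P k of
            None \<Rightarrow> P (Suc k) = None \<and> y (Suc k) = y k
          | Some p \<Rightarrow> worthy_fd_trade M \<epsilon> (y k) p \<and>
                      \<gamma> k = (GREATEST g. g \<in> admissible_factors M (y k) p) \<and>
                      y (Suc k) = y k + \<gamma> k *\<^sub>R p)"

end

(* Each arranged trade raises the welfare by at least \<epsilon> times its curtailment factor and trades have
   bounded size, so the path length of y is bounded by the total welfare gain and y converges to
   some a, even if the factors tend to 0. By the relative interior assumption and the symmetry of
   the line limits, zero injection is strictly feasible on every relevant line. Hence any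
   near-optimal plan can be moved to a z in the relative interior of the balanced plans that is
   strictly feasible for the network. If the welfare gap at a exceeded \<epsilon>, the fixed trade z - a
   would be worthy and feasible along the whole tail of the run, so it would eventually be arranged
   in full and push the welfare beyond its limit. *)

theory Submission
  imports Defs
begin

section \<open>Network loads and balanced plans\<close>

text \<open>Relaxation of the feasible set that drops the line limits and keeps power balance. It is
  compact and convex, and uncurtailed trades stay inside it.\<close>

definition balanced_plans ::
    "('n::finite, 'l::finite, 's::finite, 'i::finite) market \<Rightarrow> (real^'s^'i) set" where
  "balanced_plans M = {p. (\<forall>i. p $ i \<in> plans M i) \<and> (\<forall>s. (\<Sum>i\<in>UNIV. p $ i $ s) = 0)}"

text \<open>Regrouping participants by bus turns each load into one weighted sum over participants,
  which makes linearity and continuity in \<open>p\<close> immediate.\<close>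

lemma inner_network:
  "a \<bullet> network M p $ s = (\<Sum>i\<in>UNIV. a $ bus M i * p $ i $ s)"
proof -
  have "a \<bullet> network M p $ s = (\<Sum>n\<in>UNIV. \<Sum>i | bus M i = n. a $ bus M i * p $ i $ s)"
    by (simp add: network_def inner_vec_def sum_distrib_left)
  also have "\<dots> = (\<Sum>i\<in>UNIV. a $ bus M i * p $ i $ s)"
    using sum.group[of UNIV UNIV "bus M" "\<lambda>i. a $ bus M i * p $ i $ s"] by simp
  finally show ?thesis .
qed

lemma linear_inner_network: "linear (\<lambda>p. a \<bullet> network M p $ s)"
  by (rule linearI) (simp_all add: inner_network algebra_simps sum.distrib sum_distrib_left)

lemmas inner_network_add = linear_add[OF linear_inner_network]
lemmas inner_network_diff = linear_diff[OF linear_inner_network]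
lemmas inner_network_scale = linear_scale[OF linear_inner_network]

lemma tendsto_inner_network:
  fixes f :: "'a \<Rightarrow> real^'s::finite^'i::finite"
  assumes "(f \<longlongrightarrow> p) F"
  shows "((\<lambda>x. a \<bullet> network M (f x) $ s) \<longlongrightarrow> a \<bullet> network M p $ s) F"
  using assms unfolding inner_network by (intro tendsto_intros)

lemma network_add_scale:
  "network M (y + g *\<^sub>R p) $ s = network M y $ s + g *\<^sub>R network M p $ s"
  by (simp add: network_def vec_eq_iff sum.distrib sum_distrib_left)

lemma mem_injections_iff:
  "x \<in> injections M \<longleftrightarrow> (\<forall>l. row l (Hmat M) \<bullet> x \<le> fbar M $ l) \<and> 1 \<bullet> x = 0"
  by (simp add: injections_def less_eq_vec_def matrix_vector_mul_component row_def)

text \<open>The all-one vector sums over all buses and hence over all participants, so the network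
  part of feasibility splits into power balance and line limits.\<close>

lemma feasible_iff:
  "feasible M p \<longleftrightarrow>
     p \<in> balanced_plans M \<and> (\<forall>s l. row l (Hmat M) \<bullet> network M p $ s \<le> fbar M $ l)"
  by (auto simp: feasible_def balanced_plans_def mem_injections_iff inner_network[of 1])

section \<open>Convexity and compactness of the balanced plans\<close>

lemma convex_plans: "convex (plans M i)"
proof -
  have "convex (power_range M i s)" for s
    by (simp add: power_range_def)
  then show ?thesis
    unfolding plans_def convex_def by (auto; metis)
qed

lemma convex_balanced_plans:
  fixes M :: "('n::finite, 'l::finite, 's::finite, 'i::finite) market"
  shows "convex (balanced_plans M)"
proof (rule convexI)
  fix p q :: "real^'s^'i" and u v :: real
  assume "p \<in> balanced_plans M" "q \<in> balanced_plans M" "0 \<le> u" "0 \<le> v" "u + v = 1"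
  then show "u *\<^sub>R p + v *\<^sub>R q \<in> balanced_plans M"
    using convexD[OF convex_plans, of _ M _ _ u v]
    by (auto simp: balanced_plans_def sum.distrib simp flip: sum_distrib_left)
qed

lemma compact_balanced_plans: "compact (balanced_plans M)"
proof -
  have cl: "closed (power_range M i s)" for i s
    by (simp add: power_range_def)
  have "balanced_plans M =
      (\<Inter>i. \<Inter>s. (\<lambda>p. p $ i $ s) -` power_range M i s) \<inter>
      (\<Inter>i\<in>day_ahead M. \<Inter>s. \<Inter>t. {p. p $ i $ s = p $ i $ t}) \<inter>
      (\<Inter>s. {p. (\<Sum>i\<in>UNIV. p $ i $ s) = 0})"
    by (auto simp: balanced_plans_def plans_def)
  moreover have "closed \<dots>"
    by (intro closed_Int closed_INT ballI closed_vimage cl closed_Collect_eq continuous_intros)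
  ultimately have "closed (balanced_plans M)" by simp
  moreover have "bounded (balanced_plans M)"
  proof (rule boundedI)
    fix p assume p: "p \<in> balanced_plans M"
    have "norm (p $ i $ s) \<le> \<bar>pbar M $ i $ s\<bar>" for i s
    proof -
      have "p $ i $ s \<in> power_range M i s"
        using p by (simp add: balanced_plans_def plans_def)
      then show ?thesis by (auto simp: power_range_def split: if_splits)
    qed
    then have "norm (p $ i) \<le> norm (pbar M $ i)" for i
      by (intro norm_le_componentwise_cart[of "p $ i"]) simp
    then show "norm p \<le> norm (pbar M)"
      by (rule norm_le_componentwise_cart)
  qed
  ultimately show ?thesis by (simp add: compact_eq_bounded_closed)
qed

section \<open>Zero injection and line capacities\<close>

lemma zero_in_balanced_plans:
  assumes "valid_market M"
  shows "0 \<in> balanced_plans M"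
  using assms by (auto simp: valid_market_def balanced_plans_def plans_def power_range_def)

text \<open>A line of zero capacity that still admits a relative interior point carries no flow under
  any balanced injection, because its flow is bounded in both directions.\<close>

lemma capacity_pos_or_flow_zero:
  assumes "valid_market M"
  shows "0 < fbar M $ l \<or> (\<forall>q. 1 \<bullet> q = 0 \<longrightarrow> row l (Hmat M) \<bullet> q = 0)"
proof -
  let ?S = "{p. 1 \<bullet> p = (0::real)}"
  obtain x T where T: "openin (top_of_set ?S) T" "T \<subseteq> injections M" and x: "x \<in> T"
    using assms by (auto simp: valid_market_def interior_of_def)
  \<comment> \<open>\<open>opp\<close> is the copy of line \<open>l\<close> with reversed
    orientation in the stacked matrix; the two rows together bound the absolute flow.\<close>
  define opp where "opp = (case l of Inl a \<Rightarrow> Inr a | Inr a \<Rightarrow> Inl a)"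
  have opp: "row opp (Hmat M) \<bullet> p = - (row l (Hmat M) \<bullet> p)" "fbar M $ opp = fbar M $ l" for p
    by (cases l; simp add: opp_def Hmat_def fbar_def row_def inner_vec_def sum_negf)+
  have bound: "\<bar>row l (Hmat M) \<bullet> p\<bar> \<le> fbar M $ l" if "p \<in> T" for p
    proof -
    have "row j (Hmat M) \<bullet> p \<le> fbar M $ j" for j
      using that T(2) by (auto simp: mem_injections_iff)
    from this[of l] this[of opp] show ?thesis by (simp add: opp abs_le_iff)
  qed
  \<comment> \<open>A small step from the relative interior point \<open>x\<close> along
    \<open>q\<close> stays in \<open>T\<close>. With nonpositive capacity the flow is zero at both
    ends, hence along \<open>q\<close>.\<close>
  have "row l (Hmat M) \<bullet> q = 0" if q: "1 \<bullet> q = 0" and l: "fbar M $ l \<le> 0" for q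
  proof -
    obtain e where e: "0 < e" "ball x e \<inter> ?S \<subseteq> T"
      using T(1) x by (auto simp: openin_contains_ball)
    have "((\<lambda>t. x + t *\<^sub>R q) \<longlongrightarrow> x + 0 *\<^sub>R q) (at_right 0)"
      by (intro tendsto_intros)
    then have "\<forall>\<^sub>F t in at_right 0. dist (x + t *\<^sub>R q) x < e"
      using e(1) by (auto dest: tendstoD)
    then have "\<forall>\<^sub>F t in at_right (0::real). dist (x + t *\<^sub>R q) x < e \<and> 0 < t"
      using eventually_at_right_less by (rule eventually_conj)
    then obtain t :: real where t: "dist (x + t *\<^sub>R q) x < e" "0 < t"
      using eventually_happens'[OF trivial_limit_at_right_real] by blast
    have "1 \<bullet> x = 0" using T(2) x by (auto simp: mem_injections_iff)
    then have "x + t *\<^sub>R q \<in> T"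
      using t(1) q e(2) by (auto simp: inner_add_right dist_commute)
    from bound[OF this] bound[OF x] l
    have "row l (Hmat M) \<bullet> (x + t *\<^sub>R q) = 0" "row l (Hmat M) \<bullet> x = 0" by linarith+
    then show ?thesis using t(2) by (simp add: inner_add_right)
  qed
  then show ?thesis by force
qed

section \<open>Concavity and continuity of welfare\<close>

lemma convex_on_sum_fun:
  assumes "finite A" "convex S" "\<And>i. i \<in> A \<Longrightarrow> convex_on S (f i)"
  shows "convex_on S (\<lambda>x. \<Sum>i\<in>A. f i x)"
  using assms by (induction A) (auto simp: convex_on_const)

lemma concave_on_welfare:
  fixes M :: "('n::finite, 'l::finite, 's::finite, 'i::finite) market"
  assumes "valid_market M"
  shows "concave_on UNIV (welfare M)"
proof -
  have "convex_on UNIV (\<lambda>p. - util M i s (p $ i $ s))" for i s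
  proof (rule convex_onI)
    fix t :: real and p q :: "real^'s^'i"
    assume "0 < t" "t < 1"
    moreover have "convex_on UNIV (\<lambda>x. - util M i s x)"
      using assms by (simp add: valid_market_def concave_on_def)
    ultimately show "- util M i s (((1 - t) *\<^sub>R p + t *\<^sub>R q) $ i $ s)
        \<le> (1 - t) * - util M i s (p $ i $ s) + t * - util M i s (q $ i $ s)"
      using convex_onD[of UNIV "\<lambda>x. - util M i s x" t "p $ i $ s" "q $ i $ s"] by simp
  qed simp
  then have "convex_on UNIV (\<lambda>p. \<Sum>i\<in>UNIV. \<Sum>s\<in>UNIV. scen_prob M s * - util M i s (p $ i $ s))"
    using assms
    by (intro convex_on_sum_fun convex_on_cmul) (auto simp: valid_market_def less_imp_le)
  moreover have "(\<lambda>p. \<Sum>i\<in>UNIV. \<Sum>s\<in>UNIV. scen_prob M s * - util M i s (p $ i $ s))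
      = (\<lambda>p. - welfare M p)"
    by (simp add: welfare_def participant_utility_def sum_negf)
  ultimately show ?thesis by (simp add: concave_on_def)
qed

lemma continuous_on_welfare:
  assumes "valid_market M"
  shows "continuous_on UNIV (welfare M)"
proof -
  have "continuous_on UNIV (\<lambda>p. - welfare M p)"
    using concave_on_welfare[OF assms] by (intro convex_on_continuous) (auto simp: concave_on_def)
  from continuous_on_minus[OF this] show ?thesis by simp
qed

lemma tendsto_welfare:
  assumes "valid_market M" "(f \<longlongrightarrow> p) F"
  shows "((\<lambda>x. welfare M (f x)) \<longlongrightarrow> welfare M p) F"
  using continuous_on_tendsto_compose[OF continuous_on_welfare[OF assms(1)] assms(2)] by simp

text \<open>Concavity on the segment from \<open>y\<close> to \<open>y + p\<close>: a trade
  curtailed to the fraction \<open>g\<close> keeps at least that fraction of its gain.\<close>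

lemma welfare_add_scale_ge:
  assumes "valid_market M" "0 \<le> g" "g \<le> 1"
  shows "welfare M y + g * (welfare M (y + p) - welfare M y) \<le> welfare M (y + g *\<^sub>R p)"
proof -
  have "- welfare M ((1 - g) *\<^sub>R y + g *\<^sub>R (y + p))
      \<le> (1 - g) * - welfare M y + g * - welfare M (y + p)"
    using concave_on_welfare[OF assms(1)] assms(2,3)
    by (intro convex_onD[of UNIV]) (auto simp: concave_on_def)
  moreover have "(1 - g) *\<^sub>R y + g *\<^sub>R (y + p) = y + g *\<^sub>R p"
    by (simp add: algebra_simps)
  ultimately show ?thesis by (simp add: algebra_simps)
qed

text \<open>Welfare is continuous on the compact set \<open>balanced_plans M\<close>, which contains
  every feasible plan. The bound lets the supremum in \<open>optimal_value\<close> be used as a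
  least upper bound.\<close>

lemma bdd_above_welfare_feasible:
  assumes "valid_market M"
  shows "bdd_above (welfare M ` {p. feasible M p})"
proof -
  have "compact (welfare M ` balanced_plans M)"
    by (intro compact_continuous_image compact_balanced_plans
        continuous_on_subset[OF continuous_on_welfare[OF assms]]) simp
  then have "bdd_above (welfare M ` balanced_plans M)"
    by (intro bounded_imp_bdd_above compact_imp_bounded)
  then show ?thesis
    by (rule bdd_above_mono) (auto simp: feasible_iff)
qed

section \<open>Worthy trades and curtailment\<close>

text \<open>The group drops out: participants outside it have zero trade, so they add nothing to the
  gain and keep the admissible plans they have in \<open>y\<close>. Conversely, all participants
  together serve as a group.\<close>

lemma worthy_fd_trade_iff:
  assumes "y \<in> balanced_plans M"
  shows "worthy_fd_trade M \<epsilon> y p \<longleftrightarrow>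
    y + p \<in> balanced_plans M \<and> feasible_direction M y p \<and> welfare M y + \<epsilon> \<le> welfare M (y + p)"
proof -
  have y: "y $ i \<in> plans M i" "(\<Sum>i\<in>UNIV. y $ i $ s) = 0" for i s
    using assms by (auto simp: balanced_plans_def)
  have gain: "worthy M \<epsilon> y G p \<longleftrightarrow> welfare M y + \<epsilon> \<le> welfare M (y + p)" if "trade M y G p" for G
  proof -
    have "(\<Sum>i\<in>G. participant_utility M i (y $ i + p $ i) - participant_utility M i (y $ i))
        = welfare M (y + p) - welfare M y"
      unfolding welfare_def sum_subtractf[symmetric] vector_add_component
      by (rule sum.mono_neutral_left) (use that in \<open>auto simp: trade_def\<close>)
    then show ?thesis by (auto simp: worthy_def)
  qed
  have balanced: "y + p \<in> balanced_plans M" if "trade M y G p" for G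
  proof -
    have "y $ i + p $ i \<in> plans M i" for i
      using that y(1)[of i] by (cases "i \<in> G") (auto simp: trade_def)
    then show ?thesis
      using that y(2) by (simp add: trade_def balanced_plans_def sum.distrib)
  qed
  have trade: "trade M y UNIV p" if "y + p \<in> balanced_plans M"
    using that y by (auto simp: trade_def balanced_plans_def sum.distrib)
  show ?thesis
    unfolding worthy_fd_trade_def using gain balanced trade by blast
qed

text \<open>Plan constraints hold on the whole segment by convexity, so testing the network alone
  already tests feasibility.\<close>

lemma admissible_factors_eq:
  assumes "y \<in> balanced_plans M" "y + p \<in> balanced_plans M"
  shows "admissible_factors M y p = {g \<in> {0..1}. feasible M (y + g *\<^sub>R p)}"
proof -
  have "y + g *\<^sub>R p \<in> balanced_plans M" if "0 \<le> g" "g \<le> 1" for g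
  proof -
    have "y + g *\<^sub>R p = (1 - g) *\<^sub>R y + g *\<^sub>R (y + p)"
      by (simp add: algebra_simps)
    then show ?thesis
      using convexD[OF convex_balanced_plans assms, of "1 - g" g] that by simp
  qed
  then show ?thesis
    by (auto simp: admissible_factors_def feasible_def balanced_plans_def network_add_scale)
qed

text \<open>Compactness gives a largest factor. It is positive because a tight line is not loaded
  further in a feasible direction, a slack line has room for a small step, and there are finitely
  many lines and scenarios.\<close>

lemma feasible_max_factor:
  assumes y: "feasible M y" and p: "y + p \<in> balanced_plans M" and fd: "feasible_direction M y p"
  shows "\<exists>g\<in>admissible_factors M y p. 0 < g \<and> (\<forall>h\<in>admissible_factors M y p. h \<le> g)"
proof -
  let ?A = "admissible_factors M y p"
  let ?load = "\<lambda>l s q. row l (Hmat M) \<bullet> network M q $ s"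
  have yC: "y \<in> balanced_plans M" using y by (simp add: feasible_iff)
  note A = admissible_factors_eq[OF yC p]
  have "closed ?A"
  proof -
    have "?A = {0..1} \<inter>
        (\<Inter>s. \<Inter>l. {g. ?load l s y + g * ?load l s p \<le> fbar M $ l}) \<inter>
        (\<Inter>s. {g. 1 \<bullet> network M y $ s + g * (1 \<bullet> network M p $ s) = 0})"
      by (auto simp: admissible_factors_def mem_injections_iff inner_add_right)
    moreover have "closed \<dots>"
      by (intro closed_Int closed_INT ballI closed_Collect_le closed_Collect_eq continuous_intros
          closed_atLeastAtMost)
    ultimately show ?thesis by simp
  qed
  moreover have "bounded ?A"
    by (rule bounded_subset[of "{0..1}"]) (auto simp: admissible_factors_def)
  ultimately have "compact ?A" by (simp add: compact_eq_bounded_closed)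
  moreover have "\<exists>g\<in>?A. 0 < g"
  proof -
    have "\<forall>\<^sub>F g in at_right 0. ?load l s (y + g *\<^sub>R p) \<le> fbar M $ l" for l s
    proof (cases "?load l s y = fbar M $ l")
      case True
      then have "?load l s p \<le> 0" using fd by (simp add: feasible_direction_def)
      then show ?thesis
        using True by (intro eventually_mono[OF eventually_at_right_less])
          (simp add: inner_network_add inner_network_scale mult_nonneg_nonpos)
    next
      case False
      then have "?load l s (y + 0 *\<^sub>R p) < fbar M $ l"
        using y by (auto simp: feasible_iff less_le)
      moreover have "((\<lambda>g. ?load l s (y + g *\<^sub>R p)) \<longlongrightarrow> ?load l s (y + 0 *\<^sub>R p)) (at_right 0)"
        by (intro tendsto_inner_network tendsto_intros)
      ultimately show ?thesis
        by (blast intro: eventually_mono[OF order_tendstoD(2)] less_imp_le)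
    qed
    then have "\<forall>\<^sub>F g in at_right 0. \<forall>l s. ?load l s (y + g *\<^sub>R p) \<le> fbar M $ l"
      by (intro eventually_all_finite)
    moreover have "\<forall>\<^sub>F g in at_right (0::real). g \<in> {0<..<1}"
      by (rule eventually_at_right_real) simp
    ultimately have "\<forall>\<^sub>F g in at_right 0.
        (\<forall>l s. ?load l s (y + g *\<^sub>R p) \<le> fbar M $ l) \<and> g \<in> {0<..<1}"
      by (rule eventually_conj)
    then obtain g where g: "\<forall>l s. ?load l s (y + g *\<^sub>R p) \<le> fbar M $ l" "g \<in> {0<..<1}"
      using eventually_happens'[OF trivial_limit_at_right_real] by blast
    moreover have "y + g *\<^sub>R p = (1 - g) *\<^sub>R y + g *\<^sub>R (y + p)"
      by (simp add: algebra_simps)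
    then have "y + g *\<^sub>R p \<in> balanced_plans M"
      using convexD[OF convex_balanced_plans yC p, of "1 - g" g] g(2) by simp
    ultimately have "g \<in> ?A" by (simp add: A feasible_iff)
    then show ?thesis using g(2) by auto
  qed
  ultimately obtain g where "g \<in> ?A" "\<forall>h\<in>?A. h \<le> g"
    using compact_attains_sup[of ?A] by blast
  with \<open>\<exists>g\<in>?A. 0 < g\<close> show ?thesis by (meson less_le_trans)
qed

section \<open>Strictly feasible plans and translates of the run\<close>

text \<open>The point is \<open>p - t (p - t c)\<close> with \<open>c\<close> a relative interior point of the plans: shrinking \<open>p\<close>
  towards \<open>0\<close> frees capacity of order \<open>t\<close> on each line, while \<open>c\<close> contributes a load of order
  \<open>t\<^sup>2\<close> only.\<close>

lemma ex_strictly_feasible_welfare_gt: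
  assumes M: "valid_market M" and p: "feasible M p" and v: "v < welfare M p"
  shows "\<exists>z \<in> rel_interior (balanced_plans M). v < welfare M z \<and>
    (\<forall>s l. 0 < fbar M $ l \<longrightarrow> row l (Hmat M) \<bullet> network M z $ s < fbar M $ l)"
proof -
  let ?C = "balanced_plans M"
  let ?load = "\<lambda>l s q. row l (Hmat M) \<bullet> network M q $ s"
  have pC: "p \<in> ?C" using p by (simp add: feasible_iff)
  obtain c where c: "c \<in> rel_interior ?C"
    using rel_interior_eq_empty[OF convex_balanced_plans] pC by blast
  define z where "z t = p - t *\<^sub>R (p - t *\<^sub>R c)" for t
  have z_lim: "(z \<longlongrightarrow> p) (at_right 0)"
    unfolding z_def by (rule tendsto_eq_intros refl | simp)+
  have "\<forall>\<^sub>F t in at_right 0. 0 < fbar M $ l \<longrightarrow> ?load l s (z t) < fbar M $ l" for l s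
  proof (cases "0 < fbar M $ l")
    case True
    have "((\<lambda>t. t * ?load l s c) \<longlongrightarrow> 0) (at_right 0)"
      by (rule tendsto_eq_intros refl | simp)+
    then have "\<forall>\<^sub>F t in at_right 0. t * ?load l s c < fbar M $ l"
      using True by (auto dest: order_tendstoD(2))
    moreover have "\<forall>\<^sub>F t in at_right (0::real). t \<in> {0<..<1}"
      by (rule eventually_at_right_real) simp
    ultimately show ?thesis
    proof eventually_elim
      case (elim t)
      have "?load l s (z t) = (1 - t) * ?load l s p + t * (t * ?load l s c)"
        by (simp add: z_def inner_network_diff inner_network_scale right_diff_distrib
            left_diff_distrib)
      \<comment> \<open>Convex combination with weights \<open>1 - t\<close> and \<open>t\<close>:
        the load of \<open>p\<close> is at most the capacity, and \<open>t\<close> times the load of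
        \<open>c\<close> is strictly below it.\<close>
      also have "\<dots> < (1 - t) * fbar M $ l + t * fbar M $ l"
        using p elim by (intro add_le_less_mono mult_left_mono mult_strict_left_mono)
          (auto simp: feasible_iff)
      finally show ?case by (simp add: algebra_simps)
    qed
  qed simp
  then have "\<forall>\<^sub>F t in at_right 0. \<forall>s l. 0 < fbar M $ l \<longrightarrow> ?load l s (z t) < fbar M $ l"
    by (intro eventually_all_finite)
  moreover have "\<forall>\<^sub>F t in at_right 0. v < welfare M (z t)"
    using tendsto_welfare[OF M z_lim] v by (rule order_tendstoD(1))
  moreover have "\<forall>\<^sub>F t in at_right (0::real). t \<in> {0<..<1}"
    by (rule eventually_at_right_real) simp
  ultimately have "\<forall>\<^sub>F t in at_right 0. z t \<in> rel_interior ?C \<and> v < welfare M (z t) \<and>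
      (\<forall>s l. 0 < fbar M $ l \<longrightarrow> ?load l s (z t) < fbar M $ l)"
  proof eventually_elim
    case (elim t)
    \<comment> \<open>Two shrinkings: \<open>0\<close> moves towards \<open>c\<close>, which puts
      \<open>t *\<^sub>R c\<close> in the relative interior; then \<open>p\<close> moves towards
      that point, giving \<open>z t\<close>.\<close>
    have "0 - t *\<^sub>R (0 - c) \<in> rel_interior ?C"
      using elim c zero_in_balanced_plans[OF M]
      by (intro rel_interior_convex_shrink convex_balanced_plans) auto
    then have "z t \<in> rel_interior ?C"
      unfolding z_def using elim pC
      by (intro rel_interior_convex_shrink convex_balanced_plans) auto
    then show ?case using elim by blast
  qed
  from eventually_happens'[OF trivial_limit_at_right_real this] show ?thesis by blast
qed

text \<open>The translates converge to \<open>z\<close>. Relative interiority of \<open>z\<close>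
  makes late ones balanced plans, strictness preserves the limits of positive capacity, and the
  other lines carry no flow under balanced injections.\<close>

lemma eventually_translate_strictly_feasible:
  assumes M: "valid_market M" and z: "z \<in> rel_interior (balanced_plans M)"
    and strict: "\<And>s l. 0 < fbar M $ l \<Longrightarrow> row l (Hmat M) \<bullet> network M z $ s < fbar M $ l"
    and y: "\<And>k. y k \<in> balanced_plans M" and lim: "y \<longlonglongrightarrow> a"
  shows "\<forall>\<^sub>F k in sequentially. feasible M (y k + (z - a))"
proof -
  let ?C = "balanced_plans M"
  let ?load = "\<lambda>l s q. row l (Hmat M) \<bullet> network M q $ s"
  have lim': "(\<lambda>k. y k + (z - a)) \<longlonglongrightarrow> z"
    using tendsto_add[OF lim tendsto_const[of "z - a"]] by simp
  have a: "a \<in> ?C"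
    using compact_imp_closed[OF compact_balanced_plans] y lim by (rule closed_sequentially)
  have zC: "z \<in> ?C" using z rel_interior_subset by blast
  obtain e where e: "0 < e" "ball z e \<inter> affine hull ?C \<subseteq> ?C"
    using z by (auto simp: mem_rel_interior_ball)
  \<comment> \<open>\<open>y k\<close>, \<open>z\<close> and \<open>a\<close> lie in the hull, and
    their coefficients 1, 1, -1 sum to 1.\<close>
  have aff: "y k + (z - a) \<in> affine hull ?C" for k
  proof -
    have "y k + 1 *\<^sub>R (z - a) \<in> affine hull ?C"
      using y a zC by (intro mem_affine_3_minus affine_affine_hull hull_inc)
    then show ?thesis by simp
  qed
  have "\<forall>\<^sub>F k in sequentially. y k + (z - a) \<in> ?C"
    using tendstoD[OF lim' e(1)]
    by eventually_elim (use e(2) aff in \<open>auto simp: dist_commute\<close>)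
  moreover have "\<forall>\<^sub>F k in sequentially. 0 < fbar M $ l \<longrightarrow> ?load l s (y k + (z - a)) < fbar M $ l"
    for l s
    using order_tendstoD(2)[OF tendsto_inner_network[OF lim'] strict]
    by (cases "0 < fbar M $ l") auto
  then have "\<forall>\<^sub>F k in sequentially. \<forall>s l.
      0 < fbar M $ l \<longrightarrow> ?load l s (y k + (z - a)) < fbar M $ l"
    by (intro eventually_all_finite)
  ultimately show ?thesis
  proof eventually_elim
    case (elim k)
    have "?load l s (y k + (z - a)) \<le> fbar M $ l" for l s
    proof (cases "0 < fbar M $ l")
      case True
      then show ?thesis using elim(2) by (simp add: less_imp_le)
    next
      case False
      have "1 \<bullet> network M (y k + (z - a)) $ s = 0"
        unfolding inner_network using elim(1) by (simp add: balanced_plans_def)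
      \<comment> \<open>Some admissible injection exists; it sends no flow over this line and
        respects its limit.\<close>
      moreover have "0 \<le> fbar M $ l"
      proof -
        have "injections M \<noteq> {}"
          using M interior_of_subset[of _ "injections M"] by (auto simp: valid_market_def)
        then obtain x where x: "x \<in> injections M" by blast
        then show ?thesis
          using False capacity_pos_or_flow_zero[OF M, of l] by (metis mem_injections_iff)
      qed
      ultimately show ?thesis
        using False capacity_pos_or_flow_zero[OF M, of l] by auto
    qed
    then show ?case using elim(1) by (simp add: feasible_iff)
  qed
qed

lemma feasible_imp_feasible_direction:
  assumes "feasible M (y + p)"
  shows "feasible_direction M y p"
  unfolding feasible_direction_def
proof (intro allI impI)
  fix s l
  assume "row l (Hmat M) \<bullet> network M y $ s = fbar M $ l"
  moreover have "row l (Hmat M) \<bullet> network M (y + p) $ s \<le> fbar M $ l"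
    using assms by (simp add: feasible_iff)
  ultimately show "row l (Hmat M) \<bullet> network M p $ s \<le> 0"
    by (simp add: inner_network_add)
qed

section \<open>Convergence from finite path length\<close>

text \<open>The increments of \<open>W\<close> form a telescoping summable series whose multiple by
  \<open>c\<close> dominates the step norms; completeness does the rest.\<close>

lemma convergent_if_norm_step_le:
  fixes y :: "nat \<Rightarrow> 'a::banach" and W :: "nat \<Rightarrow> real"
  assumes step: "\<And>k. norm (y (Suc k) - y k) \<le> c * (W (Suc k) - W k)" and W: "convergent W"
  shows "convergent y"
proof -
  have "summable (\<lambda>k. W (Suc k) - W k)"
    using W telescope_summable by (auto simp: convergent_def)
  then have "summable (\<lambda>k. c * (W (Suc k) - W k))"
    by (rule summable_mult)
  then have "summable (\<lambda>k. y (Suc k) - y k)"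
    by (rule summable_comparison_test'[of _ 0]) (use step in auto)
  then have "convergent (\<lambda>n. \<Sum>k<n. y (Suc k) - y k)"
    by (simp add: summable_iff_convergent)
  then have "convergent (\<lambda>n. y n - y 0)"
    by (simp add: sum_lessThan_telescope)
  then show ?thesis
    using convergent_add[OF _ convergent_const[of "y 0"]] by fastforce
qed

section \<open>Analysis of a trading run\<close>

theorem theorem1:
  fixes M :: "('n::finite, 'l::finite, 's::finite, 'i::finite) market"
    and \<epsilon> :: real
    and y :: "nat \<Rightarrow> real^'s^'i"
    and P :: "nat \<Rightarrow> (real^'s^'i) option"
    and \<gamma> :: "nat \<Rightarrow> real"
  assumes "valid_market M"
    and "\<epsilon> > 0"
    and "trading_run M \<epsilon> y P \<gamma>"
    and no_unworthy: "\<And>k p G. P k = Some p \<Longrightarrow> trade M (y k) G p \<Longrightarrow>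
           feasible_direction M (y k) p \<Longrightarrow> worthy M \<epsilon> (y k) G p"
    and eventually_arranged: "\<And>k p. worthy_fd_trade M \<epsilon> (y k) p \<Longrightarrow>
           \<exists>k'\<ge>k. P k' = Some p \<or> \<not> worthy_fd_trade M \<epsilon> (y k') p"
    and willing: "\<And>k. \<exists>p. worthy_fd_trade M \<epsilon> (y k) p \<Longrightarrow> P k \<noteq> None"
  shows "(\<forall>k p. P k = Some p \<longrightarrow>
            0 < \<gamma> k \<and> \<gamma> k \<le> 1 \<and>
            \<gamma> k \<in> admissible_factors M (y k) p \<and>
            (\<forall>g\<in>admissible_factors M (y k) p. g \<le> \<gamma> k) \<and>
            feasible M (y (Suc k)))
       \<and> convergent (\<lambda>k. welfare M (y k))
       \<and> optimal_value M - lim (\<lambda>k. welfare M (y k)) \<le> \<epsilon>"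
proof -
  note M = \<open>valid_market M\<close>
  have start: "feasible M (y 0)"
    and run: "\<And>k. case P k of None \<Rightarrow> P (Suc k) = None \<and> y (Suc k) = y k
      | Some p \<Rightarrow> worthy_fd_trade M \<epsilon> (y k) p \<and>
          \<gamma> k = (GREATEST g. g \<in> admissible_factors M (y k) p) \<and>
          y (Suc k) = y k + \<gamma> k *\<^sub>R p"
    using assms(3) unfolding trading_run_def by blast+
  have stop: "y (Suc k) = y k" if "P k = None" for k
    using run[of k] that by simp
  have arranged: "worthy_fd_trade M \<epsilon> (y k) p"
    "\<gamma> k = (GREATEST g. g \<in> admissible_factors M (y k) p)"
    "y (Suc k) = y k + \<gamma> k *\<^sub>R p" if "P k = Some p" for k p
    using run[of k] that by simp_all
  \<comment> \<open>Feasibility of \<open>y k\<close> is a premise here so that the induction for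
    \<open>feas\<close> can use this step.\<close>
  have one_step: "0 < \<gamma> k \<and> \<gamma> k \<in> admissible_factors M (y k) p \<and>
      (\<forall>g\<in>admissible_factors M (y k) p. g \<le> \<gamma> k) \<and> feasible M (y (Suc k))"
    if k: "feasible M (y k)" "P k = Some p" for k p
  proof -
    have yC: "y k \<in> balanced_plans M" using k(1) by (simp add: feasible_iff)
    have pC: "y k + p \<in> balanced_plans M" and fd: "feasible_direction M (y k) p"
      using arranged(1)[OF k(2)] by (simp_all add: worthy_fd_trade_iff[OF yC])
    obtain g where g: "g \<in> admissible_factors M (y k) p" "0 < g"
      "\<forall>h\<in>admissible_factors M (y k) p. h \<le> g"
      using feasible_max_factor[OF k(1) pC fd] by blast
    \<comment> \<open>\<open>GREATEST\<close> is determined only once a maximum is known to exist;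
      \<open>g\<close> is that maximum.\<close>
    have "\<gamma> k = g"
      using arranged(2)[OF k(2)] g by (simp add: Greatest_equality)
    then show ?thesis
      using g arranged(3)[OF k(2)] by (auto simp: admissible_factors_eq[OF yC pC])
  qed
  have feas: "feasible M (y k)" for k
  proof (induction k)
    case (Suc k)
    then show ?case using one_step[of k] stop[of k] by (cases "P k") auto
  qed (rule start)
  have factor: "0 < \<gamma> k" "\<gamma> k \<le> 1" "\<gamma> k \<in> admissible_factors M (y k) p"
    "\<forall>g\<in>admissible_factors M (y k) p. g \<le> \<gamma> k" if "P k = Some p" for k p
    using one_step[OF feas that] by (auto simp: admissible_factors_def)
  have yC: "y k \<in> balanced_plans M" for k
    using feas[of k] by (simp add: feasible_iff)

  define W where "W k = welfare M (y k)" for k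
  obtain B where B: "\<And>p. p \<in> balanced_plans M \<Longrightarrow> norm p \<le> B"
    using compact_imp_bounded[OF compact_balanced_plans[of M]] unfolding bounded_iff by blast
  \<comment> \<open>An arranged trade is a difference of two balanced plans, so its norm is at most
    \<open>2 * B\<close>. The step has length at most \<open>\<gamma> k * (2 * B)\<close> and gains
    at least \<open>\<gamma> k * \<epsilon>\<close>; the constant is the quotient.\<close>
  have norm_step: "norm (y (Suc k) - y k) \<le> 2 * B / \<epsilon> * (W (Suc k) - W k)" for k
  proof (cases "P k")
    case (Some p)
    have p: "y k + p \<in> balanced_plans M" "\<epsilon> \<le> welfare M (y k + p) - welfare M (y k)"
      using arranged(1)[OF Some] by (auto simp: worthy_fd_trade_iff[OF yC])
    have "norm p \<le> norm (y k + p) + norm (y k)"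
      using norm_triangle_ineq4[of "y k + p" "y k"] by simp
    then have "norm p \<le> 2 * B" using B[OF p(1)] B[OF yC[of k]] by simp
    moreover have "0 \<le> 2 * B" using B[OF yC[of k]] norm_ge_zero[of "y k"] by linarith
    moreover have "\<gamma> k * \<epsilon> \<le> W (Suc k) - W k"
    proof -
      have "\<gamma> k * \<epsilon> \<le> \<gamma> k * (welfare M (y k + p) - welfare M (y k))"
        using factor(1)[OF Some] p(2) by simp
      also have "\<dots> \<le> W (Suc k) - W k"
        using welfare_add_scale_ge[OF M, of "\<gamma> k" "y k" p] factor(1,2)[OF Some] arranged(3)[OF Some]
        by (simp add: W_def)
      finally show ?thesis .
    qed
    then have "\<gamma> k \<le> (W (Suc k) - W k) / \<epsilon>"
      using \<open>\<epsilon> > 0\<close> by (simp add: pos_le_divide_eq)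
    ultimately have "\<gamma> k * norm p \<le> (W (Suc k) - W k) / \<epsilon> * (2 * B)"
      using factor(1)[OF Some] by (intro mult_mono) auto
    then show ?thesis
      using arranged(3)[OF Some] factor(1)[OF Some] by (simp add: mult.commute)
  qed (simp add: W_def stop)
  have "W k \<le> W (Suc k)" for k
  proof (cases "P k")
    case (Some p)
    have "0 \<le> \<gamma> k * (welfare M (y k + p) - welfare M (y k))"
      using factor(1)[OF Some] arranged(1)[OF Some] \<open>\<epsilon> > 0\<close>
      by (intro mult_nonneg_nonneg) (auto simp: worthy_fd_trade_iff[OF yC])
    then show ?thesis
      using welfare_add_scale_ge[OF M, of "\<gamma> k" "y k" p] factor(1,2)[OF Some] arranged(3)[OF Some]
      by (simp add: W_def)
  qed (simp add: W_def stop)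
  then have mono: "incseq W" by (rule incseq_SucI)
  note bdd = bdd_above_welfare_feasible[OF M]
  have "W k \<le> optimal_value M" for k
    unfolding optimal_value_def W_def using feas by (intro cSUP_upper bdd) simp
  then have W_conv: "convergent W"
    using incseq_convergent[OF mono] by (metis convergentI)
  obtain a where a: "y \<longlonglongrightarrow> a"
    using convergent_if_norm_step_le[OF norm_step W_conv] by (auto simp: convergent_def)
  have W_lim: "W \<longlonglongrightarrow> welfare M a"
    unfolding W_def by (rule tendsto_welfare[OF M a])

  have "optimal_value M \<le> welfare M a + \<epsilon>"
  proof (rule ccontr)
    assume "\<not> ?thesis"
    then obtain p where "feasible M p" "welfare M a + \<epsilon> < welfare M p"
      using less_cSUP_iff[OF _ bdd, of "welfare M a + \<epsilon>"] start
      by (auto simp: optimal_value_def)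
    then obtain z where z: "z \<in> rel_interior (balanced_plans M)" "welfare M a + \<epsilon> < welfare M z"
      "\<And>s l. 0 < fbar M $ l \<Longrightarrow> row l (Hmat M) \<bullet> network M z $ s < fbar M $ l"
      using ex_strictly_feasible_welfare_gt[OF M] by blast
    \<comment> \<open>This trade does not depend on \<open>k\<close>, since
      \<open>eventually_arranged\<close> follows one fixed trade; \<open>z - y k\<close> would
      change with the state.\<close>
    let ?q = "z - a"
    have "(\<lambda>k. y k + ?q) \<longlonglongrightarrow> z"
      using tendsto_add[OF a tendsto_const[of ?q]] by simp
    from order_tendstoD(1)[OF tendsto_welfare[OF M this] z(2)]
      eventually_translate_strictly_feasible[OF M z(1,3) yC a]
    have "\<forall>\<^sub>F k in sequentially. welfare M a + \<epsilon> < welfare M (y k + ?q) \<and> feasible M (y k + ?q)"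
      by (rule eventually_conj)
    then obtain K where K: "\<And>k. K \<le> k \<Longrightarrow> welfare M a + \<epsilon> < welfare M (y k + ?q)"
      "\<And>k. K \<le> k \<Longrightarrow> feasible M (y k + ?q)"
      by (auto simp: eventually_sequentially)
    have W_le: "W k \<le> welfare M a" for k
      using incseq_le[OF mono W_lim] .
    \<comment> \<open>The gap is measured from the limit \<open>welfare M a\<close>, which dominates
      every \<open>W k\<close>, so the gain is at least \<epsilon> at each late state.\<close>
    have worthy: "worthy_fd_trade M \<epsilon> (y k) ?q" if "K \<le> k" for k
      using K[OF that] W_le[of k] feasible_imp_feasible_direction[OF K(2)[OF that]]
      by (auto simp: worthy_fd_trade_iff[OF yC] feasible_iff W_def)
    \<comment> \<open>Worthiness on the whole tail rules out the second alternative of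
      \<open>eventually_arranged\<close>.\<close>
    obtain k where k: "K \<le> k" "P k = Some ?q"
      using eventually_arranged[OF worthy[OF order_refl]] worthy by blast
    \<comment> \<open>The full trade ends in a feasible plan, so it is not curtailed.\<close>
    have "1 \<in> admissible_factors M (y k) ?q"
      using K(2)[OF k(1)] by (simp add: admissible_factors_eq[OF yC] feasible_iff)
    then have "\<gamma> k = 1" using factor(2,4)[OF k(2)] by force
    then have "W (Suc k) = welfare M (y k + ?q)"
      using arranged(3)[OF k(2)] by (simp add: W_def)
    then show False using K(1)[OF k(1)] W_le[of "Suc k"] \<open>\<epsilon> > 0\<close> by simp
  qed
  then have "optimal_value M - lim W \<le> \<epsilon>"
    using limI[OF W_lim] by simp
  moreover have "W = (\<lambda>k. welfare M (y k))" by (simp add: W_def fun_eq_iff)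
  ultimately show ?thesis
    using factor feas W_conv by auto
qed

end
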